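(* Let $f:[-\pi,\pi]\to[-1,1]$ be a square-integrable function and let $\epsilon>0$. Then there exist an integer $L\ge 0$ and parameters $\boldsymbol\theta=(\theta_0,\theta_1,\ldots,\theta_L)\in\mathbb{R}^{L+1}$ and $\boldsymbol\phi=(\varphi,\phi_0,\phi_1,\ldots,\phi_L)\in\mathbb{R}^{L+2}$ such that, writing $|\psi(x)\rangle = U^{WZW}_{\boldsymbol\theta,\boldsymbol\phi,L}(x)\,|0\rangle$, one has $$\big\| \langle\psi(x)|Z|\psi(x)\rangle - f(x)\big\| \le \epsilon,$$ where $\|\cdot\|$ is the $L^2$-norm of functions of $x$ on $[-\pi,\pi]$.
   Context: For $\theta\in\mathbb{R}$ define the $2\times 2$ unitary matrices $$R_Y(\theta)=\begin{bmatrix}\cos\frac{\theta}{2}&-\sin\frac{\theta}{2}\\ \sin\frac{\theta}{2}&\cos\frac{\theta}{2}\end{bmatrix},\qquad R_Z(\theta)=\begin{bmatrix}e^{-i\theta/2}&0\\0&e^{i\theta/2}\end{bmatrix},$$ and let $Z=\begin{bmatrix}1&0\\0&-1\end{bmatrix}$, $|0\rangle=(1,0)^T\in\mathbb{C}^2$. For a vector $|\psi\rangle\in\mathbb{C}^2$, $\langle\psi|$ denotes its conjugate transpose, so $\langle\psi|Z|\psi\rangle=|\psi_0|^2-|\psi_1|^2$ for $|\psi\rangle=(\psi_0,\psi_1)^T$. Put $W(\theta,\phi)=R_Y(\theta)R_Z(\phi)$. For an integer $L\ge0$, $\boldsymbol\theta=(\theta_0,\ldots,\theta_L)\in\mathbb{R}^{L+1}$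 and $\boldsymbol\phi=(\varphi,\phi_0,\ldots,\phi_L)\in\mathbb{R}^{L+2}$, the $L$-layer single-qubit quantum neural network (QNN) is the matrix-valued function of $x\in\mathbb{R}$ $$U^{WZW}_{\boldsymbol\theta,\boldsymbol\phi,L}(x)=R_Z(\varphi)\,W(\theta_0,\phi_0)\prod_{j=1}^{L}R_Z(x)\,W(\theta_j,\phi_j),$$ where the product is ordered from left to right with increasing $j$ (so the $j=L$ factor is the rightmost and acts first on $|0\rangle$). *)

theory Defs
  imports "HOL-Analysis.Analysis"
begin

definition R_Y :: "real \<Rightarrow> complex^2^2" where
  "R_Y \<theta> = vector [vector [of_real (cos (\<theta> / 2)), - of_real (sin (\<theta> / 2))],
                   vector [of_real (sin (\<theta> / 2)), of_real (cos (\<theta> / 2))]]"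

definition R_Z :: "real \<Rightarrow> complex^2^2" where
  "R_Z \<theta> = vector [vector [exp (- \<i> * of_real \<theta> / 2), 0],
                   vector [0, exp (\<i> * of_real \<theta> / 2)]]"

definition pauli_Z :: "complex^2^2" where
  "pauli_Z = vector [vector [1, 0], vector [0, -1]]"

definition ket0 :: "complex^2" where
  "ket0 = vector [1, 0]"

text \<open>The number \<open>\<langle>\<psi>|A|\<psi>\<rangle>\<close>, with \<open>\<langle>\<psi>|\<close> the conjugate transpose of \<open>\<psi>\<close>; it is kept complex.\<close>

definition expval :: "complex^'n^'n \<Rightarrow> complex^'n \<Rightarrow> complex" where
  "expval A \<psi> = (\<Sum>i\<in>UNIV. cnj (\<psi> $ i) * (A *v \<psi>) $ i)"

definition W :: "real \<Rightarrow> real \<Rightarrow> complex^2^2" where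
  "W \<theta> \<phi> = R_Y \<theta> ** R_Z \<phi>"

text \<open>
  Parameter vectors are sequences of which only the entries with index at most \<open>L\<close> are used, so
  \<open>\<theta>\<close> stands for \<open>(\<theta>\<^sub>0, \<dots>, \<theta>\<^sub>L)\<close>. The vector \<open>(\<phi>', \<phi>\<^sub>0, \<dots>, \<phi>\<^sub>L)\<close> is split into its
  initial entry \<open>\<phi>'\<close> and the rest. Each new layer is multiplied on the right.
\<close>

primrec U_WZW :: "(nat \<Rightarrow> real) \<Rightarrow> real \<Rightarrow> (nat \<Rightarrow> real) \<Rightarrow> nat \<Rightarrow> real \<Rightarrow> complex^2^2" where
  "U_WZW \<theta> \<phi>' \<phi> 0 x = R_Z \<phi>' ** W (\<theta> 0) (\<phi> 0)"
| "U_WZW \<theta> \<phi>' \<phi> (Suc L) x =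
     U_WZW \<theta> \<phi>' \<phi> L x ** (R_Z x ** W (\<theta> (Suc L)) (\<phi> (Suc L)))"

definition square_integrable_on ::
    "('a::euclidean_space \<Rightarrow> 'b::{banach, second_countable_topology}) \<Rightarrow> 'a set \<Rightarrow> bool" where
  "square_integrable_on f S \<longleftrightarrow>
     set_borel_measurable lebesgue S f \<and> set_integrable lebesgue S (\<lambda>x. (norm (f x))\<^sup>2)"

text \<open>Only meaningful for functions that are square-integrable on \<open>S\<close>.\<close>

definition L2_norm_on ::
    "'a::euclidean_space set \<Rightarrow> ('a \<Rightarrow> 'b::{banach, second_countable_topology}) \<Rightarrow> real" where
  "L2_norm_on S f = sqrt (set_lebesgue_integral lebesgue S (\<lambda>x. (norm (f x))\<^sup>2))"

end

theory Submission
  imports Defs "HOL-Computational_Algebra.Fundamental_Theorem_Algebra"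
begin

text \<open>
  On the circle \<open>z = cis x\<close> the output state is, up to a phase, a pair \<open>(P z, Q z)\<close> of polynomials of
  degree at most \<open>L\<close> with \<open>\<bar>P\<bar>\<^sup>2 + \<bar>Q\<bar>\<^sup>2 = 1\<close>, and stripping layers from the left shows
  that every such pair occurs. Given a real trigonometric polynomial \<open>p\<close> with \<open>\<bar>p\<bar> < 1\<close>, the
  Fejer--Riesz theorem writes \<open>(1 + p) / 2 = \<bar>P\<bar>\<^sup>2\<close> and \<open>(1 - p) / 2 = \<bar>Q\<bar>\<^sup>2\<close>, so the
  expectation \<open>\<bar>P\<bar>\<^sup>2 - \<bar>Q\<bar>\<^sup>2\<close> is exactly \<open>p\<close>. Finally \<open>f\<close> is an almost everywhere limit of
  such \<open>p\<close>, hence an \<open>L\<^sup>2\<close>-limit by dominated convergence.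
\<close>

section \<open>Polynomials on the unit circle\<close>

text \<open>The difference vanishes at infinitely many points, since \<open>cis\<close> is injective
  on \<open>{0..1}\<close>; a nonzero polynomial has only finitely many roots.\<close>

lemma poly_eq_if_eq_on_circle:
  fixes p q :: "complex poly"
  assumes "\<And>z. norm z = 1 \<Longrightarrow> poly p z = poly q z"
  shows "p = q"
proof (rule ccontr)
  assume "p \<noteq> q"
  then have "finite {z. poly (p - q) z = 0}"
    by (intro poly_roots_finite) simp
  moreover have "sphere 0 1 \<subseteq> {z. poly (p - q) z = 0}"
    using assms by auto
  ultimately have "finite (sphere (0::complex) 1)"
    by (rule rev_finite_subset)
  moreover have "inj_on cis {0..1}"
  proof (rule inj_onI)
    fix x y :: real
    assume "x \<in> {0..1}" "y \<in> {0..1}" "cis x = cis y"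
    moreover from this have "x \<in> {-pi<..pi}" "y \<in> {-pi<..pi}"
      using pi_gt3 by auto
    ultimately show "x = y"
      using Arg_cis by metis
  qed
  then have "infinite (cis ` {0..1})"
    by (simp add: finite_image_iff infinite_Icc)
  moreover have "cis ` {0..1} \<subseteq> sphere 0 1"
    by auto
  ultimately show False
    using finite_subset by blast
qed

lemma degree_less_if_coeff_eq_0:
  assumes "degree p \<le> Suc n" "coeff p (Suc n) = 0"
  shows "degree p \<le> n"
  by (metis assms degree_0 le_SucE leading_coeff_0_iff zero_le)

section \<open>Conjugate reflection and nonnegative trigonometric polynomials\<close>

text \<open>The reciprocal polynomial with conjugated coefficients. The length \<open>m\<close> is a
  parameter because only a bound on the degree is available: leading coefficients may
  vanish.\<close>

definition conj_reflect :: "nat \<Rightarrow> complex poly \<Rightarrow> complex poly" where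
  "conj_reflect m p = (\<Sum>k\<le>m. monom (cnj (coeff p (m - k))) k)"

lemma coeff_conj_reflect:
  "coeff (conj_reflect m p) k = (if k \<le> m then cnj (coeff p (m - k)) else 0)"
  by (simp add: conj_reflect_def coeff_sum)

lemma poly_conj_reflect:
  assumes "degree p \<le> m" "w \<noteq> 0"
  shows "poly (conj_reflect m p) w = w ^ m * cnj (poly p (1 / cnj w))"
proof -
  have "poly p (1 / cnj w) = (\<Sum>k\<le>m. coeff p k * (1 / cnj w) ^ k)"
    unfolding poly_altdef using assms(1) by (intro sum.mono_neutral_left) (auto simp: coeff_eq_0)
  then have "w ^ m * cnj (poly p (1 / cnj w)) = (\<Sum>k\<le>m. cnj (coeff p k) * (w ^ m * (1 / w) ^ k))"
    by (simp add: sum_distrib_left mult_ac)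
  also have "\<dots> = (\<Sum>k\<le>m. cnj (coeff p k) * w ^ (m - k))"
    using assms(2) by (intro sum.cong) (auto simp: power_diff power_divide)
  also have "\<dots> = (\<Sum>k\<le>m. cnj (coeff p (m - k)) * w ^ k)"
    by (rule sum.reindex_bij_witness[of _ "\<lambda>k. m - k" "\<lambda>k. m - k"]) auto
  finally show ?thesis
    by (simp add: conj_reflect_def poly_sum poly_monom)
qed

lemma poly_conj_reflect_circle:
  assumes "degree p \<le> m" "norm w = 1"
  shows "poly (conj_reflect m p) w = w ^ m * cnj (poly p w)"
proof -
  have "w * cnj w = 1"
    using assms(2) by (simp add: complex_norm_square[symmetric])
  moreover from this have "w \<noteq> 0"
    by auto
  ultimately have "w \<noteq> 0" "1 / cnj w = w"
    by (simp_all add: divide_eq_eq)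
  then show ?thesis
    using poly_conj_reflect[OF assms(1)] by metis
qed

text \<open>
  Fejer--Riesz for strictly positive trigonometric polynomials. The polynomial \<open>p\<close> is its own
  conjugate reflection, so its roots come in pairs \<open>r\<close>, \<open>1 / cnj r\<close>, and
  \<open>(z - r) * (1 - cnj r * z) = z * \<bar>z - r\<bar>\<^sup>2\<close> on the circle.
\<close>

lemma fejer_riesz:
  assumes "degree p \<le> 2 * n"
    and "\<And>z. norm z = 1 \<Longrightarrow> \<exists>r>0. poly p z = z ^ n * complex_of_real r"
  shows "\<exists>q. degree q \<le> n \<and>
    (\<forall>z. norm z = 1 \<longrightarrow> poly p z = z ^ n * complex_of_real ((norm (poly q z))\<^sup>2))"
  using assms
proof (induction n arbitrary: p)
  case 0
  then obtain c where c: "p = [:c:]"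
    by (metis degree_eq_zeroE le_zero_eq mult_0_right)
  from "0.prems"(2)[of 1] obtain r where "r > 0" "c = complex_of_real r"
    using c by auto
  then show ?case
    using c by (intro exI[of _ "[:complex_of_real (sqrt r):]"]) (simp flip: of_real_power)
next
  case (Suc n)
  let ?m = "2 * Suc n"
  have z_cnj: "z * cnj z = 1" "z \<noteq> 0" if "norm z = 1" for z :: complex
    using that by (auto simp: complex_norm_square[symmetric])
  have refl: "conj_reflect ?m p = p"
  proof (rule poly_eq_if_eq_on_circle)
    fix z :: complex
    assume z: "norm z = 1"
    with Suc.prems(2) obtain r where r: "poly p z = z ^ Suc n * complex_of_real r"
      by blast
    have "poly (conj_reflect ?m p) z = z ^ ?m * cnj (z ^ Suc n * complex_of_real r)"
      using poly_conj_reflect_circle[OF Suc.prems(1) z] r by simp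
    also have "\<dots> = z ^ Suc n * (z * cnj z) ^ Suc n * complex_of_real r"
      unfolding mult_2 power_add complex_cnj_mult complex_cnj_power complex_cnj_complex_of_real
        power_mult_distrib by (simp only: mult_ac)
    finally show "poly (conj_reflect ?m p) z = poly p z"
      using r z_cnj(1)[OF z] by simp
  qed
  then have top: "coeff p ?m = cnj (coeff p 0)"
    using coeff_conj_reflect[of ?m p ?m] by simp
  show ?case
  proof (cases "coeff p 0 = 0")
    case True
    then obtain p' where p': "p = pCons 0 p'"
      by (metis coeff_pCons_0 pCons_cases)
    \<comment> \<open>By self-reflection the top coefficient vanishes together with the constant
      one, so dividing by \<open>z\<close> lowers the degree bound by two. On the circle this
      division leaves the modulus alone, so the same \<open>q\<close> serves.\<close>
    have "degree p \<le> Suc (2 * n)"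
    proof (rule degree_less_if_coeff_eq_0)
      show "degree p \<le> Suc (Suc (2 * n))"
        using Suc.prems(1) by simp
      have "?m = Suc (Suc (2 * n))"
        by simp
      then show "coeff p (Suc (Suc (2 * n))) = 0"
        using top True by (simp only: complex_cnj_zero)
    qed
    then have "degree p' \<le> 2 * n"
      using p' by (cases "p' = 0") auto
    moreover have "\<exists>r>0. poly p' z = z ^ n * complex_of_real r" if "norm z = 1" for z
      using Suc.prems(2)[OF that] z_cnj(2)[OF that] p' by auto
    ultimately obtain q where "degree q \<le> n"
      "\<forall>z. norm z = 1 \<longrightarrow> poly p' z = z ^ n * complex_of_real ((norm (poly q z))\<^sup>2)"
      using Suc.IH by blast
    then show ?thesis
      using p' by (intro exI[of _ q]) auto
  next
    case False
    then have "degree p = ?m"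
      using top Suc.prems(1) le_degree[of p ?m] by simp
    then have "\<not> constant (poly p)"
      by (simp add: constant_degree)
    then obtain r where r: "poly p r = 0"
      using fundamental_theorem_of_algebra by blast
    have r0: "r \<noteq> 0"
      using False r by (auto simp: poly_0_coeff_0)
    \<comment> \<open>Strict positivity keeps roots off the circle; hence \<open>r\<close> and its
      mirror image \<open>s\<close> are distinct and both linear factors can be split off.\<close>
    have r1: "norm r \<noteq> 1"
    proof
      assume "norm r = 1"
      with Suc.prems(2) r show False
        using r0 by fastforce
    qed
    define s where "s = 1 / cnj r"
    have s0: "s \<noteq> 0" and sr: "s * cnj r = 1"
      using r0 by (auto simp: s_def)
    have "poly p s = s ^ ?m * cnj (poly p (1 / cnj s))"
      using poly_conj_reflect[OF Suc.prems(1) s0] refl by simp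
    then have ps: "poly p s = 0"
      using r by (simp add: s_def)
    have "s \<noteq> r"
    proof
      assume "s = r"
      then have "complex_of_real ((norm r)\<^sup>2) = 1"
        using sr by (simp only: complex_norm_square)
      then have "(norm r)\<^sup>2 = 1"
        using of_real_eq_1_iff by blast
      then show False
        using r1 power_eq_1_iff[of "norm r" 2] by simp
    qed
    obtain p1 where p1: "p = [:- r, 1:] * p1"
      using r by (auto simp: poly_eq_0_iff_dvd)
    then have "poly p1 s = 0"
      using ps \<open>s \<noteq> r\<close> by simp
    then obtain p2 where p2: "p1 = [:- s, 1:] * p2"
      by (auto simp: poly_eq_0_iff_dvd)
    \<comment> \<open>The constant comes from \<open>z - s = - s * (1 - cnj r * z)\<close>; it makes
      \<open>p'\<close> positive again after division by
      \<open>z * \<bar>z - r\<bar>^2\<close>.\<close>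
    define p' where "p' = smult (- s) p2"
    have "p2 \<noteq> 0"
      using False p1 p2 by auto
    then have "degree p = degree p2 + 2"
      unfolding p1 p2 by (simp add: degree_mult_eq del: mult_pCons_left)
    then have "degree p' \<le> 2 * n"
      using Suc.prems(1) by (simp add: p'_def)
    have poly_p: "poly p z = z * complex_of_real ((norm (z - r))\<^sup>2) * poly p' z" if "norm z = 1" for z
    proof -
      have "z * complex_of_real ((norm (z - r))\<^sup>2) = (z - r) * (z * cnj z - cnj r * z)"
        unfolding complex_norm_square by (simp add: algebra_simps)
      then have "z * complex_of_real ((norm (z - r))\<^sup>2) = (z - r) * (1 - cnj r * z)"
        using z_cnj(1)[OF that] by simp
      moreover have "z - s = (1 - cnj r * z) * (- s)"
        using sr by (simp add: algebra_simps)
      moreover have "poly p z = (z - r) * (z - s) * poly p2 z"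
        by (simp add: p1 p2 algebra_simps)
      ultimately show ?thesis
        by (simp add: p'_def)
    qed
    have "\<exists>t>0. poly p' z = z ^ n * complex_of_real t" if z: "norm z = 1" for z
    proof -
      obtain t where t: "t > 0" "poly p z = z ^ Suc n * complex_of_real t"
        using Suc.prems(2)[OF z] by blast
      have pos: "(norm (z - r))\<^sup>2 > 0"
        using r1 z by auto
      have "complex_of_real ((norm (z - r))\<^sup>2) * poly p' z = z ^ n * complex_of_real t"
        using t(2) poly_p[OF z] z_cnj(2)[OF z] by (simp add: mult.assoc)
      then have "poly p' z = z ^ n * complex_of_real (t / (norm (z - r))\<^sup>2)"
        using pos by (simp add: field_simps)
      then show ?thesis
        using t(1) pos by (intro exI[of _ "t / (norm (z - r))\<^sup>2"]) auto
    qed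
    then obtain q where q: "degree q \<le> n"
      "\<forall>z. norm z = 1 \<longrightarrow> poly p' z = z ^ n * complex_of_real ((norm (poly q z))\<^sup>2)"
      using Suc.IH[OF \<open>degree p' \<le> 2 * n\<close>] by blast
    have "degree ([:- r, 1:] * q) \<le> Suc n"
      using q(1) degree_mult_le[of "[:- r, 1:]" q] by simp
    moreover have "poly p z = z ^ Suc n * complex_of_real ((norm (poly ([:- r, 1:] * q) z))\<^sup>2)"
      if "norm z = 1" for z
    proof -
      have "poly ([:- r, 1:] * q) z = (z - r) * poly q z"
        by (simp add: algebra_simps)
      then show ?thesis
        using poly_p[OF that] q(2) that by (simp add: norm_mult power_mult_distrib)
    qed
    ultimately show ?thesis
      by blast
  qed
qed

text \<open>On the circle \<open>cnj z = 1 / z\<close>, so a polynomial in \<open>Re z\<close> and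
  \<open>Im z\<close> is a Laurent polynomial in \<open>z\<close>; the factor \<open>z ^ n\<close>
  clears its negative powers.\<close>

lemma real_polynomial_function_on_circle:
  fixes f :: "complex \<Rightarrow> real"
  assumes "real_polynomial_function f"
  shows "\<exists>n q. degree q \<le> 2 * n \<and> (\<forall>z. norm z = 1 \<longrightarrow> poly q z = z ^ n * complex_of_real (f z))"
  using assms
proof (induction rule: real_polynomial_function.induct)
  case (linear f)
  interpret bounded_linear f by fact
  \<comment> \<open>By linearity \<open>f z = Re z * f 1 + Im z * f \<i>\<close>, and on the circle
    \<open>z * Re z = (z^2 + 1) / 2\<close> and
    \<open>z * Im z = - \<i> * (z^2 - 1) / 2\<close>.\<close>
  define q where "q = smult (complex_of_real (f 1) / 2) [:1, 0, 1:]
    + smult (- \<i> * complex_of_real (f \<i>) / 2) [:- 1, 0, 1:]"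
  have "degree q \<le> 2"
    unfolding q_def by (intro degree_add_le) simp_all
  moreover have "poly q z = z * complex_of_real (f z)" if "norm z = 1" for z
  proof -
    have zz: "z * cnj z = 1"
      using that by (simp add: complex_norm_square[symmetric])
    have "z = Re z *\<^sub>R 1 + Im z *\<^sub>R \<i>"
      by (simp add: complex_eq_iff)
    from arg_cong[OF this, of f] have "f z = f (Re z *\<^sub>R 1 + Im z *\<^sub>R \<i>)" .
    then have fz: "complex_of_real (f z)
        = (z + cnj z) / 2 * complex_of_real (f 1) - \<i> * (z - cnj z) / 2 * complex_of_real (f \<i>)"
      unfolding add scaleR by (simp add: complex_eq_iff)
    have "z * complex_of_real (f z) = (z * z + z * cnj z) / 2 * complex_of_real (f 1)
        - \<i> * (z * z - z * cnj z) / 2 * complex_of_real (f \<i>)"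
      unfolding fz by (simp add: field_simps)
    then show ?thesis
      unfolding zz q_def by (simp add: field_simps)
  qed
  ultimately show ?case
    by (intro exI[of _ 1] exI[of _ q]) simp
next
  case (const c)
  show ?case
    by (intro exI[of _ 0] exI[of _ "[:complex_of_real c:]"]) simp
next
  case (add f g)
  then obtain m p n q where "degree p \<le> 2 * m" "degree q \<le> 2 * n"
    and "\<And>z. norm z = 1 \<Longrightarrow> poly p z = z ^ m * complex_of_real (f z)"
    and "\<And>z. norm z = 1 \<Longrightarrow> poly q z = z ^ n * complex_of_real (g z)"
    by blast
  \<comment> \<open>The monomials bring both summands to the common prefactor
    \<open>z ^ (m + n)\<close>.\<close>
  moreover have "degree (p * monom 1 n + q * monom 1 m) \<le> 2 * (m + n)"
    using calculation(1,2) degree_mult_le[of p "monom 1 n"] degree_mult_le[of q "monom 1 m"]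
    by (intro degree_add_le) (auto simp: degree_monom_eq)
  ultimately show ?case
    by (intro exI[of _ "m + n"] exI[of _ "p * monom 1 n + q * monom 1 m"])
      (simp add: poly_monom power_add algebra_simps)
next
  case (mult f g)
  then obtain m p n q where "degree p \<le> 2 * m" "degree q \<le> 2 * n"
    and "\<And>z. norm z = 1 \<Longrightarrow> poly p z = z ^ m * complex_of_real (f z)"
    and "\<And>z. norm z = 1 \<Longrightarrow> poly q z = z ^ n * complex_of_real (g z)"
    by blast
  moreover have "degree (p * q) \<le> 2 * (m + n)"
    using calculation(1,2) degree_mult_le[of p q] by simp
  ultimately show ?case
    by (intro exI[of _ "m + n"] exI[of _ "p * q"]) (simp add: power_add algebra_simps)
qed

section \<open>Layer stripping\<close>

lemma R_Z_mult_vec: "R_Z a *v vector [u, v] = vector [cis (- a / 2) * u, cis (a / 2) * v]"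
  by (simp add: R_Z_def vec_eq_iff forall_2 matrix_vector_mult_def sum_2 cis_conv_exp)

lemma R_Y_mult_vec:
  "R_Y b *v vector [u, v] = vector [of_real (cos (b / 2)) * u - of_real (sin (b / 2)) * v, of_real (sin (b / 2)) * u + of_real (cos (b / 2)) * v]"
  by (simp add: R_Y_def vec_eq_iff forall_2 matrix_vector_mult_def sum_2)

lemma R_Z_commute: "R_Z a ** R_Z b = R_Z b ** R_Z a"
  by (simp add: R_Z_def vec_eq_iff forall_2 matrix_matrix_mult_def sum_2 mult.commute)

lemma expval_pauli_Z:
  "expval pauli_Z (vector [u, v]) = complex_of_real ((norm u)\<^sup>2 - (norm v)\<^sup>2)"
  unfolding of_real_diff complex_norm_square
  by (simp add: expval_def pauli_Z_def matrix_vector_mult_def sum_2 mult.commute)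

text \<open>The definition appends layers on the right, but stripping works on the left. The old
  initial angle \<open>\<phi>'\<close> becomes the \<open>R_Z\<close> angle of the new first block,
  since \<open>R_Z \<phi>'\<close> commutes with \<open>R_Z x\<close>.\<close>

lemma U_WZW_add_front:
  "U_WZW (case_nat b \<theta>) a (case_nat \<phi>' \<phi>) (Suc L) x = R_Z a ** R_Y b ** R_Z x ** U_WZW \<theta> \<phi>' \<phi> L x"
proof (induction L)
  case 0
  have "R_Z a ** R_Y b ** R_Z \<phi>' ** R_Z x = R_Z a ** R_Y b ** R_Z x ** R_Z \<phi>'"
    by (simp only: R_Z_commute[of \<phi>' x] flip: matrix_mul_assoc)
  then show ?case
    by (simp add: W_def matrix_mul_assoc)
next
  case (Suc L)
  then show ?case
    by (simp add: matrix_mul_assoc)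
qed

text \<open>Bloch sphere coordinates: up to a scalar \<open>c\<close>, every vector is the first
  column of \<open>R_Z a ** R_Y b\<close>.\<close>

lemma spinor_polar:
  fixes p q :: complex
  obtains a b :: real and c :: complex
    where "p = c * (cis (- a / 2) * of_real (cos (b / 2)))" "q = c * (cis (a / 2) * of_real (sin (b / 2)))"
proof -
  obtain r t where rt: "norm p = r * cos t" "norm q = r * sin t"
    using polar_Ex by blast
  define a where "a = Arg q - Arg p"
  define b where "b = 2 * t"
  define c where "c = of_real r * cis ((Arg p + Arg q) / 2)"
  have "p = of_real (norm p) * cis (Arg p)" "q = of_real (norm q) * cis (Arg q)"
    using rcis_cmod_Arg[of p] rcis_cmod_Arg[of q] by (simp_all add: rcis_def)
  moreover have "cis (Arg p) = cis ((Arg p + Arg q) / 2) * cis (- a / 2)"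
    "cis (Arg q) = cis ((Arg p + Arg q) / 2) * cis (a / 2)"
    by (simp_all add: cis_mult a_def field_simps)
  ultimately have "p = c * (cis (- a / 2) * of_real (cos (b / 2)))" "q = c * (cis (a / 2) * of_real (sin (b / 2)))"
    by (simp_all add: c_def b_def rt mult_ac)
  then show ?thesis
    by (rule that)
qed

text \<open>If the first column of \<open>R_Z a ** R_Y b\<close> is parallel to
  \<open>(p, q)\<close>, it is orthogonal to \<open>(r, s)\<close>. The inverse rotation then kills
  the second component of \<open>(p, q)\<close> and the first component of
  \<open>(r, s)\<close>.\<close>

lemma rotation_aligning_orthogonal:
  fixes p q r s :: complex
  assumes "p * cnj r + q * cnj s = 0"
  obtains a b :: real
    where "of_real (cos (b / 2)) * (cis (- a / 2) * q) - of_real (sin (b / 2)) * (cis (a / 2) * p) = 0"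
      "of_real (cos (b / 2)) * (cis (a / 2) * r) + of_real (sin (b / 2)) * (cis (- a / 2) * s) = 0"
proof -
  obtain u v where uv: "u * cnj r + v * cnj s = 0" "p * v = q * u"
    "u = 0 \<and> v = 0 \<longrightarrow> p = 0 \<and> q = 0 \<and> r = 0 \<and> s = 0"
  proof (cases "p = 0 \<and> q = 0")
    case True
    then show ?thesis
      \<comment> \<open>With \<open>(p, q) = 0\<close> only orthogonality to \<open>(r, s)\<close>
        remains, and this vector achieves it.\<close>
      by (intro that[of "- cnj s" "cnj r"]) auto
  next
    case False
    then show ?thesis
      using assms by (intro that[of p q]) auto
  qed
  obtain a b c where abc: "u = c * (cis (- a / 2) * of_real (cos (b / 2)))" "v = c * (cis (a / 2) * of_real (sin (b / 2)))"
    using spinor_polar .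
  show ?thesis
  proof (cases "c = 0")
    case True
    then show ?thesis
      using abc uv(3) by (intro that[of b a]) auto
  next
    case False
    have "c * (cis (a / 2) * of_real (sin (b / 2)) * p) = c * (cis (- a / 2) * of_real (cos (b / 2)) * q)"
      using uv(2) by (simp add: abc mult_ac)
    then have 1: "cis (a / 2) * of_real (sin (b / 2)) * p = cis (- a / 2) * of_real (cos (b / 2)) * q"
      using False by simp
    have "c * (cis (- a / 2) * of_real (cos (b / 2)) * cnj r + cis (a / 2) * of_real (sin (b / 2)) * cnj s) = 0"
      using uv(1) by (simp add: abc algebra_simps)
    then have "cnj (cis (- a / 2) * of_real (cos (b / 2)) * cnj r + cis (a / 2) * of_real (sin (b / 2)) * cnj s) = 0"
      using False by simp
    then have 2: "cis (a / 2) * of_real (cos (b / 2)) * r + cis (- a / 2) * of_real (sin (b / 2)) * s = 0"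
      by (simp add: cis_cnj)
    show ?thesis
      using 1 2 by (intro that[of b a]) (simp_all add: mult_ac)
  qed
qed

lemma norm_rotation:
  fixes u v :: complex and t :: real
  shows "(norm (of_real (cos t) * u + of_real (sin t) * v))\<^sup>2 + (norm (of_real (cos t) * v - of_real (sin t) * u))\<^sup>2 = (norm u)\<^sup>2 + (norm v)\<^sup>2"
proof -
  have "(norm (of_real c * u + of_real s * v))\<^sup>2 + (norm (of_real c * v - of_real s * u))\<^sup>2
      = (c\<^sup>2 + s\<^sup>2) * ((norm u)\<^sup>2 + (norm v)\<^sup>2)" for c s :: real
    unfolding cmod_power2 by (simp add: power2_eq_square algebra_simps)
  from this[of "cos t" "sin t"] show ?thesis
    by simp
qed

text \<open>
  Orthogonality of the extreme coefficient vectors (the coefficient of \<open>z\<^sup>L\<close> in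
  \<open>\<bar>P\<bar>\<^sup>2 + \<bar>Q\<bar>\<^sup>2 = 1\<close>) lets one rotation lower the degree of the first component and
  make the second divisible by \<open>z\<close>; then \<open>R_Z x\<close> can be split off.
\<close>

lemma U_WZW_realizes_polynomial_pair:
  assumes "degree P \<le> L" "degree Q \<le> L"
    and "\<And>z. norm z = 1 \<Longrightarrow> (norm (poly P z))\<^sup>2 + (norm (poly Q z))\<^sup>2 = 1"
  shows "\<exists>\<theta> \<phi>' \<phi>. \<forall>x. \<exists>c. norm c = 1 \<and>
    U_WZW \<theta> \<phi>' \<phi> L x *v ket0 = vector [c * poly P (cis x), c * poly Q (cis x)]"
  using assms
proof (induction L arbitrary: P Q)
  case 0
  then obtain p q where PQ: "P = [:p:]" "Q = [:q:]"
    by (metis degree_eq_zeroE le_zero_eq)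
  obtain a b c where abc: "p = c * (cis (- a / 2) * of_real (cos (b / 2)))" "q = c * (cis (a / 2) * of_real (sin (b / 2)))"
    using spinor_polar .
  have "(norm c)\<^sup>2 * ((cos (b / 2))\<^sup>2 + (sin (b / 2))\<^sup>2) = 1"
    using "0.prems"(3)[of 1] unfolding PQ abc
    by (simp add: norm_mult power_mult_distrib distrib_left del: sin_cos_squared_add2)
  then have c: "norm c = 1"
    using power_eq_1_iff[of "norm c" 2] by simp
  then have "c \<noteq> 0"
    by auto
  \<comment> \<open>The angle 0 turns the rightmost \<open>R_Z\<close> into the identity; dividing
    by \<open>c\<close> is a change of phase.\<close>
  have "U_WZW (\<lambda>_. b) a (\<lambda>_. 0) 0 x *v ket0 = vector [1 / c * poly P (cis x), 1 / c * poly Q (cis x)]" for x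
    using \<open>c \<noteq> 0\<close> by (simp add: W_def ket0_def R_Z_mult_vec R_Y_mult_vec PQ abc
        flip: matrix_vector_mul_assoc)
  moreover have "norm (1 / c) = 1"
    using c by (simp add: norm_divide)
  ultimately show ?case
    by blast
next
  case (Suc L)
  have "P * conj_reflect (Suc L) P + Q * conj_reflect (Suc L) Q = monom 1 (Suc L)"
  proof (rule poly_eq_if_eq_on_circle)
    fix z :: complex
    assume z: "norm z = 1"
    have "poly (P * conj_reflect (Suc L) P + Q * conj_reflect (Suc L) Q) z
        = z ^ Suc L * (poly P z * cnj (poly P z) + poly Q z * cnj (poly Q z))"
      using poly_conj_reflect_circle[OF Suc.prems(1) z] poly_conj_reflect_circle[OF Suc.prems(2) z]
      by (simp add: algebra_simps)
    also have "\<dots> = z ^ Suc L * complex_of_real ((norm (poly P z))\<^sup>2 + (norm (poly Q z))\<^sup>2)"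
      unfolding of_real_add complex_norm_square ..
    finally show "poly (P * conj_reflect (Suc L) P + Q * conj_reflect (Suc L) Q) z = poly (monom 1 (Suc L)) z"
      using Suc.prems(3)[OF z] by (simp add: poly_monom)
  qed
  \<comment> \<open>The constant term of the right side is 0 because \<open>Suc L > 0\<close>; on
    the left, lowest coefficients meet conjugated top ones.\<close>
  from arg_cong[OF this, of "\<lambda>p. coeff p 0"]
  have "coeff P 0 * cnj (coeff P (Suc L)) + coeff Q 0 * cnj (coeff Q (Suc L)) = 0"
    by (simp add: coeff_mult coeff_conj_reflect)
  then obtain a b where ab:
    "of_real (cos (b / 2)) * (cis (- a / 2) * coeff Q 0) - of_real (sin (b / 2)) * (cis (a / 2) * coeff P 0) = 0"
    "of_real (cos (b / 2)) * (cis (a / 2) * coeff P (Suc L)) + of_real (sin (b / 2)) * (cis (- a / 2) * coeff Q (Suc L)) = 0"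
    by (rule rotation_aligning_orthogonal)
  \<comment> \<open>\<open>(P1, Q1)\<close> is the image of \<open>(P, Q)\<close> under the inverse
    of \<open>R_Z a ** R_Y b\<close>.\<close>
  define P1 where "P1 = smult (of_real (cos (b / 2)) * cis (a / 2)) P + smult (of_real (sin (b / 2)) * cis (- a / 2)) Q"
  define Q1 where "Q1 = smult (of_real (cos (b / 2)) * cis (- a / 2)) Q - smult (of_real (sin (b / 2)) * cis (a / 2)) P"
  have P1: "poly P1 z = of_real (cos (b / 2)) * (cis (a / 2) * poly P z) + of_real (sin (b / 2)) * (cis (- a / 2) * poly Q z)" for z
    by (simp add: P1_def mult.assoc)
  have Q1: "poly Q1 z = of_real (cos (b / 2)) * (cis (- a / 2) * poly Q z) - of_real (sin (b / 2)) * (cis (a / 2) * poly P z)" for z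
    by (simp add: Q1_def mult.assoc)
  have deg: "degree P1 \<le> Suc L" "degree Q1 \<le> Suc L"
    unfolding P1_def Q1_def using Suc.prems(1,2)
    by (auto intro!: degree_add_le degree_diff_le order.trans[OF degree_smult_le])
  have "coeff P1 (Suc L) = 0"
    using ab(2) by (simp add: P1_def mult.assoc)
  with deg(1) have "degree P1 \<le> L"
    by (rule degree_less_if_coeff_eq_0)
  have "coeff Q1 0 = 0"
    using ab(1) by (simp add: Q1_def mult.assoc)
  then obtain Q' where Q': "Q1 = pCons 0 Q'"
    by (metis coeff_pCons_0 pCons_cases)
  then have "degree Q' \<le> L"
    using deg(2) by (cases "Q' = 0") auto
  have "(norm (poly P1 z))\<^sup>2 + (norm (poly Q' z))\<^sup>2 = 1" if "norm z = 1" for z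
  proof -
    have "norm (poly Q' z) = norm (poly Q1 z)"
      using that by (simp add: Q' norm_mult)
    then have "(norm (poly P1 z))\<^sup>2 + (norm (poly Q' z))\<^sup>2
        = (norm (cis (a / 2) * poly P z))\<^sup>2 + (norm (cis (- a / 2) * poly Q z))\<^sup>2"
      by (simp only: P1 Q1 norm_rotation)
    then show ?thesis
      using Suc.prems(3)[OF that] by (simp add: norm_mult)
  qed
  then obtain \<theta> \<phi>' \<phi> where IH: "\<And>x. \<exists>c. norm c = 1 \<and>
      U_WZW \<theta> \<phi>' \<phi> L x *v ket0 = vector [c * poly P1 (cis x), c * poly Q' (cis x)]"
    using Suc.IH[OF \<open>degree P1 \<le> L\<close> \<open>degree Q' \<le> L\<close>] by blast
  have "\<exists>c. norm c = 1 \<and> U_WZW (case_nat b \<theta>) a (case_nat \<phi>' \<phi>) (Suc L) x *v ket0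
      = vector [c * poly P (cis x), c * poly Q (cis x)]" for x
  proof -
    obtain c where c: "norm c = 1"
      "U_WZW \<theta> \<phi>' \<phi> L x *v ket0 = vector [c * poly P1 (cis x), c * poly Q' (cis x)]"
      using IH by blast
    \<comment> \<open>\<open>R_Z x\<close> is \<open>diag(1, cis x)\<close> up to the phase
      \<open>cis (- x / 2)\<close>: it restores the factor \<open>z\<close> in
      \<open>Q1 = z * Q'\<close>, and \<open>d\<close> absorbs the phase.\<close>
    define d where "d = cis (- x / 2) * c"
    have "cis (x / 2) = cis (- x / 2) * cis x"
      by (simp add: cis_mult)
    then have "R_Z x *v (U_WZW \<theta> \<phi>' \<phi> L x *v ket0)
        = vector [d * poly P1 (cis x), d * poly Q1 (cis x)]"
      by (simp add: c(2) R_Z_mult_vec d_def Q' mult_ac)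
    moreover have "of_real (cos (b / 2)) * (d * poly P1 z) - of_real (sin (b / 2)) * (d * poly Q1 z)
        = complex_of_real ((cos (b / 2))\<^sup>2 + (sin (b / 2))\<^sup>2) * (d * (cis (a / 2) * poly P z))" for z
      unfolding P1 Q1 of_real_add of_real_power by algebra
    moreover have "of_real (sin (b / 2)) * (d * poly P1 z) + of_real (cos (b / 2)) * (d * poly Q1 z)
        = complex_of_real ((cos (b / 2))\<^sup>2 + (sin (b / 2))\<^sup>2) * (d * (cis (- a / 2) * poly Q z))" for z
      unfolding P1 Q1 of_real_add of_real_power by algebra
    moreover have "cis (- a / 2) * (d * (cis (a / 2) * w)) = d * w"
      "cis (a / 2) * (d * (cis (- a / 2) * w)) = d * w" for w
      by (simp_all add: cis_mult mult.left_commute[of d] mult.assoc[symmetric, of "cis _"])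
    ultimately have "R_Z a *v (R_Y b *v (R_Z x *v (U_WZW \<theta> \<phi>' \<phi> L x *v ket0)))
        = vector [d * poly P (cis x), d * poly Q (cis x)]"
      by (simp only: R_Y_mult_vec R_Z_mult_vec sin_cos_squared_add2 of_real_1 mult_1)
    then have "U_WZW (case_nat b \<theta>) a (case_nat \<phi>' \<phi>) (Suc L) x *v ket0
        = vector [d * poly P (cis x), d * poly Q (cis x)]"
      by (simp only: U_WZW_add_front flip: matrix_vector_mul_assoc)
    moreover have "norm d = 1"
      using c(1) by (simp add: d_def norm_mult)
    ultimately show ?thesis
      by blast
  qed
  then show ?case
    by blast
qed

section \<open>Exact realization of bounded trigonometric polynomials\<close>

lemma expval_U_WZW_realizes:
  fixes f :: "complex \<Rightarrow> real"
  assumes "real_polynomial_function f" and "\<And>z. norm z = 1 \<Longrightarrow> \<bar>f z\<bar> < 1"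
  shows "\<exists>L \<theta> \<phi>' \<phi>. \<forall>x. expval pauli_Z (U_WZW \<theta> \<phi>' \<phi> L x *v ket0) = complex_of_real (f (cis x))"
proof -
  obtain n q where q: "degree q \<le> 2 * n"
    "\<And>z. norm z = 1 \<Longrightarrow> poly q z = z ^ n * complex_of_real (f z)"
    using real_polynomial_function_on_circle[OF assms(1)] by blast
  \<comment> \<open>The signs \<open>s = 1\<close> and \<open>s = - 1\<close> give the two
    components. The strict bound on \<open>f\<close> supplies the positivity that
    \<open>fejer_riesz\<close> asks for.\<close>
  have *: "\<exists>P. degree P \<le> n \<and> (\<forall>z. norm z = 1 \<longrightarrow> (norm (poly P z))\<^sup>2 = (1 + s * f z) / 2)"
    if s: "\<bar>s\<bar> = 1" for s
  proof -
    define g where "g = (\<lambda>z. (1 + s * f z) / 2)"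
    define p where "p = smult (1 / 2) (monom 1 n + smult (complex_of_real s) q)"
    have "degree p \<le> 2 * n"
      unfolding p_def using q(1) degree_monom_le[of "1 :: complex" n]
      by (auto intro!: degree_add_le order.trans[OF degree_smult_le])
    moreover have p: "poly p z = z ^ n * complex_of_real (g z)" if "norm z = 1" for z
      using q(2)[OF that] by (simp add: p_def g_def poly_monom algebra_simps add_divide_distrib)
    moreover have "g z > 0" if "norm z = 1" for z
    proof -
      have "\<bar>s * f z\<bar> < 1"
        using assms(2)[OF that] s by (simp add: abs_mult)
      then show ?thesis
        by (simp add: g_def)
    qed
    ultimately obtain P where P: "degree P \<le> n"
      "\<forall>z. norm z = 1 \<longrightarrow> poly p z = z ^ n * complex_of_real ((norm (poly P z))\<^sup>2)"
      using fejer_riesz[of p n] by blast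
    have "(norm (poly P z))\<^sup>2 = g z" if "norm z = 1" for z
    proof -
      have "z ^ n * complex_of_real ((norm (poly P z))\<^sup>2) = z ^ n * complex_of_real (g z)"
        using P(2) p that by metis
      moreover have "z \<noteq> 0"
        using that by auto
      ultimately show ?thesis
        by (metis mult_cancel_left of_real_eq_iff power_not_zero)
    qed
    then show ?thesis
      using P(1) unfolding g_def by blast
  qed
  obtain P Q where PQ: "degree P \<le> n" "degree Q \<le> n"
    "\<And>z. norm z = 1 \<Longrightarrow> (norm (poly P z))\<^sup>2 = (1 + 1 * f z) / 2"
    "\<And>z. norm z = 1 \<Longrightarrow> (norm (poly Q z))\<^sup>2 = (1 + - 1 * f z) / 2"
    using *[of 1] *[of "- 1"] by auto
  have "(norm (poly P z))\<^sup>2 + (norm (poly Q z))\<^sup>2 = 1" if "norm z = 1" for z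
    unfolding PQ(3)[OF that] PQ(4)[OF that] by (simp add: field_simps)
  then obtain \<theta> \<phi>' \<phi> where U: "\<And>x. \<exists>c. norm c = 1 \<and>
      U_WZW \<theta> \<phi>' \<phi> n x *v ket0 = vector [c * poly P (cis x), c * poly Q (cis x)]"
    using U_WZW_realizes_polynomial_pair[OF PQ(1,2)] by blast
  have "expval pauli_Z (U_WZW \<theta> \<phi>' \<phi> n x *v ket0) = complex_of_real (f (cis x))" for x
  proof -
    obtain c where "norm c = 1"
      "U_WZW \<theta> \<phi>' \<phi> n x *v ket0 = vector [c * poly P (cis x), c * poly Q (cis x)]"
      using U by blast
    then have "expval pauli_Z (U_WZW \<theta> \<phi>' \<phi> n x *v ket0)
        = complex_of_real ((norm (poly P (cis x)))\<^sup>2 - (norm (poly Q (cis x)))\<^sup>2)"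
      by (simp add: expval_pauli_Z norm_mult)
    then show ?thesis
      using PQ(3,4)[of "cis x"] by (simp add: field_simps)
  qed
  then show ?thesis
    by blast
qed

section \<open>Approximation by trigonometric polynomials\<close>

text \<open>The factor vanishing at \<open>-1\<close> hides the jump of \<open>Arg\<close> there.\<close>

lemma continuous_on_circle_cutoff:
  fixes g :: "real \<Rightarrow> real" and k :: real
  assumes "continuous_on UNIV g" and "\<And>x. \<bar>g x\<bar> \<le> 1" and "k \<ge> 0"
  shows "continuous_on (sphere 0 1) (\<lambda>z. g (Arg z) * min 1 (k * (1 + Re z)))"
proof (rule continuous_at_imp_continuous_on, intro ballI)
  fix z :: complex
  assume z: "z \<in> sphere 0 1"
  let ?H = "\<lambda>z. g (Arg z) * min 1 (k * (1 + Re z))"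
  have g: "isCont g x" for x
    using assms(1) continuous_on_eq_continuous_at by blast
  show "isCont ?H z"
  proof (cases "z = - 1")
    case True
    have "(\<lambda>z. k * (1 + Re z)) \<midarrow>- 1\<rightarrow> k * (1 + Re (- 1))"
      by (intro tendsto_intros)
    then have lim: "(\<lambda>z. \<bar>k * (1 + Re z)\<bar>) \<midarrow>- 1\<rightarrow> 0"
      by (intro tendsto_rabs_zero) simp
    have "\<bar>?H w\<bar> \<le> 1 * \<bar>k * (1 + Re w)\<bar>" for w
      unfolding abs_mult[of "g _"] by (intro mult_mono assms(2)) auto
    then have "?H \<midarrow>- 1\<rightarrow> 0"
      by (intro Lim_null_comparison[OF _ lim]) simp
    then show ?thesis
      using True by (simp add: isCont_def)
  next
    case False
    have "z \<notin> \<real>\<^sub>\<le>\<^sub>0"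
    proof
      assume "z \<in> \<real>\<^sub>\<le>\<^sub>0"
      then obtain r where "r \<le> 0" "z = of_real r"
        by (auto elim!: nonpos_Reals_cases)
      then show False
        using z False by auto
    qed
    then have "isCont (\<lambda>z. g (Arg z)) z"
      using isCont_o2[OF continuous_at_Arg g] by simp
    then show ?thesis
      by (intro continuous_intros linear_continuous_at[OF bounded_linear_Re])
  qed
qed

text \<open>Measurability yields continuous functions converging to \<open>f\<close> almost
  everywhere. These are clipped to \<open>[-1, 1]\<close>, carried to the circle with a cutoff at
  \<open>-1\<close>, shrunk slightly, and replaced by polynomials via Stone-Weierstrass.\<close>

lemma measurable_on_trig_approx:
  fixes f :: "real \<Rightarrow> real"
  assumes "f measurable_on {-pi..pi}" and "\<And>x. x \<in> {-pi..pi} \<Longrightarrow> \<bar>f x\<bar> \<le> 1"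
  obtains N and p :: "nat \<Rightarrow> complex \<Rightarrow> real"
  where "negligible N" and "\<And>n. real_polynomial_function (p n)"
    and "\<And>n z. norm z = 1 \<Longrightarrow> \<bar>p n z\<bar> < 1"
    and "\<And>x. x \<in> {-pi..pi} - N \<Longrightarrow> (\<lambda>n. p n (cis x)) \<longlonglongrightarrow> f x"
proof -
  obtain N g where N: "negligible N" and g: "\<And>n. continuous_on UNIV (g n)"
    and lim: "\<And>x. x \<notin> N \<Longrightarrow> (\<lambda>n. g n x) \<longlonglongrightarrow> (if x \<in> {-pi..pi} then f x else 0)"
    using assms(1) unfolding measurable_on_def by blast
  define h where "h n x = max (- 1) (min 1 (g n x))" for n :: nat and x
  define H where "H n z = h n (Arg z) * min 1 (real n * (1 + Re z))" for n z
  \<comment> \<open>The shift by three keeps \<open>1 - 2 * e n\<close> nonnegative. Shrinking by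
    this factor leaves room for a uniform error \<open>e n\<close> while staying strictly below
    1.\<close>
  define e where "e n = inverse (real (Suc (Suc (Suc n))))" for n
  have h: "continuous_on UNIV (h n)" "\<bar>h n x\<bar> \<le> 1" for n x
    unfolding h_def using g by (auto intro!: continuous_intros)
  have H: "\<bar>H n z\<bar> \<le> 1" if "norm z = 1" for n z
  proof -
    have "Re z \<ge> - 1"
      using abs_Re_le_cmod[of z] that by simp
    then have "\<bar>min 1 (real n * (1 + Re z))\<bar> \<le> 1"
      by simp
    then show ?thesis
      unfolding H_def abs_mult using h(2) by (intro mult_le_one) auto
  qed
  have e: "e n > 0" "2 * e n \<le> 1" for n
    by (auto simp: e_def field_simps)
  have "\<exists>p. real_polynomial_function p \<and> (\<forall>z\<in>sphere 0 1. \<bar>(1 - 2 * e n) * H n z - p z\<bar> < e n)" for n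
  proof -
    have "continuous_on (sphere 0 1) (\<lambda>z. (1 - 2 * e n) * H n z)"
      unfolding H_def by (intro continuous_on_mult_left continuous_on_circle_cutoff h) simp
    then show ?thesis
      using Stone_Weierstrass_real_polynomial_function[of "sphere 0 1"] e(1) compact_sphere by metis
  qed
  then obtain p where p: "\<And>n. real_polynomial_function (p n)"
    "\<And>n z. norm z = 1 \<Longrightarrow> \<bar>(1 - 2 * e n) * H n z - p n z\<bar> < e n"
    by (metis mem_sphere_0)
  show ?thesis
  \<comment> \<open>The endpoints join the null set because both map to \<open>-1\<close>, where the
    cutoff is 0.\<close>
  proof (rule that[of "N \<union> {-pi, pi}" p])
    show "negligible (N \<union> {-pi, pi})"
      using N by (intro negligible_Un) auto
    show "real_polynomial_function (p n)" for n
      by (rule p)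
    show "\<bar>p n z\<bar> < 1" if "norm z = 1" for n z
    proof -
      have "\<bar>(1 - 2 * e n) * H n z\<bar> \<le> (1 - 2 * e n) * 1"
        unfolding abs_mult using H[OF that] e(2)[of n] by (intro mult_mono) auto
      moreover have "\<bar>b\<bar> < 1" if "\<bar>a\<bar> \<le> (1 - 2 * c) * 1" "\<bar>a - b\<bar> < c" for a b c :: real
        using that by (simp add: abs_le_iff abs_less_iff)
      ultimately show ?thesis
        using p(2)[OF that] by blast
    qed
    fix x
    assume "x \<in> {-pi..pi} - (N \<union> {-pi, pi})"
    then have x: "x \<in> {-pi<..<pi}" "x \<notin> N"
      by auto
    have e_lim: "e \<longlonglongrightarrow> 0"
      using LIMSEQ_ignore_initial_segment[OF LIMSEQ_inverse_real_of_nat, of 2]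
      by (simp add: e_def[abs_def])
    have "(\<lambda>n. g n x) \<longlonglongrightarrow> f x"
      using lim[OF x(2)] x(1) by simp
    then have "(\<lambda>n. h n x) \<longlonglongrightarrow> max (- 1) (min 1 (f x))"
      unfolding h_def by (intro tendsto_intros)
    then have h_lim: "(\<lambda>n. h n x) \<longlonglongrightarrow> f x"
      using assms(2)[of x] x(1) by (simp add: abs_le_iff max_def min_def split: if_splits)
    have "cos x > - 1"
    proof -
      have "cos \<bar>x\<bar> > cos pi"
        using x(1) by (intro cos_monotone_0_pi) auto
      then show ?thesis
        by simp
    qed
    \<comment> \<open>At a fixed interior point the cutoff is eventually 1, so it does not affect
      the limit.\<close>
    then have "eventually (\<lambda>n. real n \<ge> 1 / (1 + cos x)) sequentially"
      by (meson eventually_sequentiallyI nat_ceiling_le_eq)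
    then have "eventually (\<lambda>n. min 1 (real n * (1 + cos x)) = 1) sequentially"
      by eventually_elim (use \<open>cos x > - 1\<close> in \<open>simp add: field_simps\<close>)
    then have "(\<lambda>n. min 1 (real n * (1 + cos x))) \<longlonglongrightarrow> 1"
      by (rule tendsto_eventually)
    then have "(\<lambda>n. (1 - 2 * e n) * (h n x * min 1 (real n * (1 + cos x))))
        \<longlonglongrightarrow> (1 - 2 * 0) * (f x * 1)"
      by (intro tendsto_intros h_lim e_lim)
    then have "(\<lambda>n. (1 - 2 * e n) * H n (cis x)) \<longlonglongrightarrow> (1 - 2 * 0) * (f x * 1)"
      using x(1) by (simp only: H_def Arg_cis cis.sel greaterThanAtMost_iff greaterThanLessThan_iff less_imp_le)
    moreover have "(\<lambda>n. (1 - 2 * e n) * H n (cis x) - p n (cis x)) \<longlonglongrightarrow> 0"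
      by (rule Lim_null_comparison[OF _ e_lim]) (use p(2)[of "cis x"] in \<open>simp add: less_imp_le\<close>)
    ultimately have "(\<lambda>n. (1 - 2 * e n) * H n (cis x) - ((1 - 2 * e n) * H n (cis x) - p n (cis x)))
        \<longlonglongrightarrow> (1 - 2 * 0) * (f x * 1) - 0"
      by (rule tendsto_diff)
    then show "(\<lambda>n. p n (cis x)) \<longlonglongrightarrow> f x"
      by simp
  qed
qed

section \<open>From almost everywhere convergence to the \<open>L^2\<close> norm\<close>

theorem theorem4:
  fixes f :: "real \<Rightarrow> real" and \<epsilon> :: real
  assumes "\<And>x. x \<in> {-pi..pi} \<Longrightarrow> f x \<in> {-1..1}"
    and "square_integrable_on f {-pi..pi}"
    and "\<epsilon> > 0"
  shows "\<exists>(L::nat) (\<theta>::nat \<Rightarrow> real) (\<phi>'::real) (\<phi>::nat \<Rightarrow> real).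
           L2_norm_on {-pi..pi}
             (\<lambda>x. expval pauli_Z (U_WZW \<theta> \<phi>' \<phi> L x *v ket0) - complex_of_real (f x)) \<le> \<epsilon>"
proof -
  let ?I = "{-pi..pi} :: real set"
  have meas: "(\<lambda>x. indicator ?I x * f x) \<in> borel_measurable lebesgue"
    using assms(2) by (simp add: square_integrable_on_def set_borel_measurable_def)
  have "(\<lambda>x. indicator ?I x * f x) measurable_on ?I"
    by (rule lebesgue_measurable_imp_measurable_on[OF meas]) simp
  then obtain N p where N: "negligible N" and p: "\<And>n. real_polynomial_function (p n)"
    and p_less: "\<And>n z. norm z = 1 \<Longrightarrow> \<bar>p n z\<bar> < 1"
    and lim: "\<And>x. x \<in> ?I - N \<Longrightarrow> (\<lambda>n. p n (cis x)) \<longlonglongrightarrow> indicator ?I x * f x"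
    by (rule measurable_on_trig_approx) (use assms(1) in \<open>auto simp: abs_le_iff\<close>)
  define d where "d n x = indicator ?I x * (p n (cis x) - indicator ?I x * f x)\<^sup>2" for n x
  have "(\<lambda>n. integral\<^sup>L lebesgue (d n)) \<longlonglongrightarrow> integral\<^sup>L lebesgue (\<lambda>x :: real. 0 :: real)"
  \<comment> \<open>Both \<open>p n\<close> and \<open>f\<close> take values in
    \<open>[-1, 1]\<close>, so the squared error is at most \<open>2^2\<close>.\<close>
  proof (rule integral_dominated_convergence[where w = "\<lambda>x. indicator ?I x * 4"])
    show "d n \<in> borel_measurable lebesgue" for n
    proof -
      have "continuous_on UNIV (\<lambda>x. p n (cis x))"
        using p[of n] by (intro continuous_on_compose2[OF continuous_on_polymonial_function continuous_on_cis])
          (auto simp: real_polynomial_function_eq intro: continuous_intros)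
      then have "(\<lambda>x. p n (cis x)) \<in> borel_measurable lebesgue"
        by (intro measurable_completion) (simp add: borel_measurable_continuous_onI)
      then show ?thesis
        unfolding d_def
        by (intro borel_measurable_times borel_measurable_power borel_measurable_diff meas
            borel_measurable_indicator) simp_all
    qed
    show "integrable lebesgue (\<lambda>x. indicator ?I x * 4 :: real)"
      by simp
    have "AE x in lebesgue. x \<notin> N"
      using N by (simp add: AE_not_in negligible_iff_null_sets)
    then show "AE x in lebesgue. (\<lambda>n. d n x) \<longlonglongrightarrow> 0"
    proof eventually_elim
      case (elim x)
      show ?case
      proof (cases "x \<in> ?I")
        case True
        then have "(\<lambda>n. indicator ?I x * (p n (cis x) - indicator ?I x * f x)\<^sup>2)
            \<longlonglongrightarrow> indicator ?I x * (indicator ?I x * f x - indicator ?I x * f x)\<^sup>2"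
          using elim by (intro tendsto_intros lim) simp
        then show ?thesis
          by (simp add: d_def)
      qed (simp add: d_def)
    qed
    show "AE x in lebesgue. norm (d n x) \<le> indicator ?I x * 4" for n
    proof (rule AE_I2)
      fix x
      show "norm (d n x) \<le> indicator ?I x * 4"
      proof (cases "x \<in> ?I")
        case True
        then have "\<bar>p n (cis x) - f x\<bar> \<le> 2"
          using p_less[of "cis x" n] assms(1)[OF True] by auto
        then have "(p n (cis x) - f x)\<^sup>2 \<le> 2\<^sup>2"
          by (rule power2_le_iff_abs_le[THEN iffD2, rotated]) simp
        then show ?thesis
          using True by (simp add: d_def)
      qed (simp add: d_def)
    qed
  qed simp
  \<comment> \<open>The threshold is squared because the norm is the square root of this
    integral.\<close>
  then have "eventually (\<lambda>n. integral\<^sup>L lebesgue (d n) < \<epsilon>\<^sup>2) sequentially"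
    using assms(3) by (intro order_tendstoD(2)) auto
  then obtain n where n: "integral\<^sup>L lebesgue (d n) < \<epsilon>\<^sup>2"
    by (meson eventually_happens sequentially_bot)
  obtain L \<theta> \<phi>' \<phi> where
    U: "\<And>x. expval pauli_Z (U_WZW \<theta> \<phi>' \<phi> L x *v ket0) = complex_of_real (p n (cis x))"
    using expval_U_WZW_realizes[OF p p_less] by blast
  have "indicator ?I x *\<^sub>R (norm (complex_of_real (p n (cis x)) - complex_of_real (f x)))\<^sup>2 = d n x" for x
    by (simp add: d_def indicator_def flip: of_real_diff)
  then have "L2_norm_on ?I (\<lambda>x. expval pauli_Z (U_WZW \<theta> \<phi>' \<phi> L x *v ket0) - complex_of_real (f x))
      = sqrt (integral\<^sup>L lebesgue (d n))"
    unfolding L2_norm_on_def set_lebesgue_integral_def U by simp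
  also have "\<dots> \<le> \<epsilon>"
    using n assms(3) by (intro real_le_lsqrt) auto
  finally show ?thesis
    by blast
qed

end
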